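(* Let $(X,* )$ be a finite connected quandle. Then there is no non-discrete $T_0$-topology on $X$ that makes $X$ into a right topological quandle.
   Context: A quandle is a set $X$ with a binary operation $*$ such that: (1) $x*x=x$ for all $x$; (2) for all $y,z\in X$ there is a unique $x\in X$ with $x*y=z$; (3) $(x*y)*z=(x*z)*(y*z)$ for all $x,y,z$. The right multiplications $R_y:X\to X$, $R_y(x)=x*y$, are automorphisms of $X$; the subgroup of the automorphism group they generate is the inner automorphism group $\mathrm{Inn}(X)$. The quandle $X$ is connected if $\mathrm{Inn}(X)$ acts transitively on $X$ (this is algebraic, not topological, connectedness). A right topological quandle is a quandle with a topology in which all right multiplications $R_y$ are continuous. *)

theory Defs
  imports "HOL-Analysis.Analysis" "HOL-Algebra.Group_Action" "HOL-Algebra.Generated_Groups"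
begin

locale quandle =
  fixes X :: "'a set" and m :: "'a \<Rightarrow> 'a \<Rightarrow> 'a" (infixl \<open>\<star>\<close> 70)
  assumes closed: "\<lbrakk>x \<in> X; y \<in> X\<rbrakk> \<Longrightarrow> x \<star> y \<in> X"
    and idem: "x \<in> X \<Longrightarrow> x \<star> x = x"
    and right_div: "\<lbrakk>y \<in> X; z \<in> X\<rbrakk> \<Longrightarrow> \<exists>!x. x \<in> X \<and> x \<star> y = z"
    and distrib: "\<lbrakk>x \<in> X; y \<in> X; z \<in> X\<rbrakk> \<Longrightarrow> (x \<star> y) \<star> z = (x \<star> z) \<star> (y \<star> z)"

(* Restricted to X because the elements of BijGroup X are extensional functions. *)
definition right_mult :: "'a set \<Rightarrow> ('a \<Rightarrow> 'a \<Rightarrow> 'a) \<Rightarrow> 'a \<Rightarrow> 'a \<Rightarrow> 'a" where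
  "right_mult X m y = (\<lambda>x\<in>X. m x y)"

definition quandle_auto :: "'a set \<Rightarrow> ('a \<Rightarrow> 'a \<Rightarrow> 'a) \<Rightarrow> ('a \<Rightarrow> 'a) set" where
  "quandle_auto X m = {f \<in> Bij X. \<forall>x\<in>X. \<forall>y\<in>X. f (m x y) = m (f x) (f y)}"

definition quandle_Aut :: "'a set \<Rightarrow> ('a \<Rightarrow> 'a \<Rightarrow> 'a) \<Rightarrow> ('a \<Rightarrow> 'a) monoid" where
  "quandle_Aut X m = BijGroup X \<lparr>carrier := quandle_auto X m\<rparr>"

definition quandle_Inn :: "'a set \<Rightarrow> ('a \<Rightarrow> 'a \<Rightarrow> 'a) \<Rightarrow> ('a \<Rightarrow> 'a) monoid" where
  "quandle_Inn X m =
     (quandle_Aut X m) \<lparr>carrier := generate (quandle_Aut X m) (right_mult X m ` X)\<rparr>"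

definition connected_quandle :: "'a set \<Rightarrow> ('a \<Rightarrow> 'a \<Rightarrow> 'a) \<Rightarrow> bool" where
  "connected_quandle X m \<longleftrightarrow> quandle X m \<and> transitive_action (quandle_Inn X m) X (\<lambda>f. f)"

definition right_topological_quandle ::
    "'a set \<Rightarrow> ('a \<Rightarrow> 'a \<Rightarrow> 'a) \<Rightarrow> 'a topology \<Rightarrow> bool" where
  "right_topological_quandle X m T \<longleftrightarrow>
     quandle X m \<and> topspace T = X \<and> (\<forall>y\<in>X. continuous_map T T (right_mult X m y))"

context quandle
begin

lemma right_mult_in_auto:
  assumes y: "y \<in> X"
  shows "right_mult X m y \<in> quandle_auto X m"
proof -
  have "inj_on (right_mult X m y) X"
  proof (rule inj_onI)
    fix a b assume ab: "a \<in> X" "b \<in> X" "right_mult X m y a = right_mult X m y b"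
    then have "a \<star> y = b \<star> y" by (simp add: right_mult_def)
    then show "a = b" using right_div[OF y closed[OF \<open>b \<in> X\<close> y]] ab by blast
  qed
  moreover have "right_mult X m y ` X = X"
  proof
    show "right_mult X m y ` X \<subseteq> X" using closed y by (auto simp: right_mult_def)
    show "X \<subseteq> right_mult X m y ` X"
    proof
      fix z assume "z \<in> X"
      then obtain x where "x \<in> X" "x \<star> y = z" using right_div[OF y] by blast
      then have "x \<in> X" "z = right_mult X m y x" by (simp_all add: right_mult_def)
      then show "z \<in> right_mult X m y ` X" by blast
    qed
  qed
  ultimately show ?thesis
    using closed[OF _ y] closed distrib[OF _ _ y]
    by (simp add: quandle_auto_def Bij_def bij_betw_def) (simp add: right_mult_def)
qed

lemma subgroup_quandle_auto: "subgroup (quandle_auto X m) (BijGroup X)"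
proof (rule group.subgroupI[OF group_BijGroup])
  show "quandle_auto X m \<subseteq> carrier (BijGroup X)"
    by (auto simp: quandle_auto_def BijGroup_def)
  show "quandle_auto X m \<noteq> {}"
    using id_Bij[of X] closed by (auto simp: quandle_auto_def intro!: exI[of _ "\<lambda>x\<in>X. x"])
next
  fix f assume f: "f \<in> quandle_auto X m"
  then have B: "f \<in> Bij X" by (simp add: quandle_auto_def)
  have "inv_into X f (x \<star> y) = inv_into X f x \<star> inv_into X f y" if "x \<in> X" "y \<in> X" for x y
    by (rule Bij_inv_into_lemma) (use f B that closed in \<open>auto simp: quandle_auto_def\<close>)
  then show "inv\<^bsub>BijGroup X\<^esub> f \<in> quandle_auto X m"
    using B closed restrict_inv_into_Bij[OF B] by (auto simp: inv_BijGroup quandle_auto_def)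
next
  fix f g assume "f \<in> quandle_auto X m" "g \<in> quandle_auto X m"
  then show "f \<otimes>\<^bsub>BijGroup X\<^esub> g \<in> quandle_auto X m"
    using closed Bij_imp_funcset[of g X]
    by (auto simp: quandle_auto_def BijGroup_def compose_Bij compose_eq Pi_iff)
qed

lemma group_quandle_Aut: "group (quandle_Aut X m)"
  unfolding quandle_Aut_def
  using group.subgroup_imp_group[OF group_BijGroup subgroup_quandle_auto] .

lemma subgroup_quandle_Inn: "subgroup (carrier (quandle_Inn X m)) (quandle_Aut X m)"
proof -
  have "right_mult X m ` X \<subseteq> carrier (quandle_Aut X m)"
    using right_mult_in_auto by (auto simp: quandle_Aut_def)
  from group.generate_is_subgroup[OF group_quandle_Aut this] show ?thesis
    by (simp add: quandle_Inn_def)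
qed

(* Hence, for a quandle, transitive_action only adds transitivity. *)
lemma group_action_quandle_Inn: "group_action (quandle_Inn X m) X (\<lambda>f. f)"
proof -
  have "group (quandle_Inn X m)"
    using group.subgroup_imp_group[OF group_quandle_Aut subgroup_quandle_Inn]
    by (simp add: quandle_Inn_def)
  moreover have "carrier (quandle_Inn X m) \<subseteq> carrier (BijGroup X)"
    using subgroup.subset[OF subgroup_quandle_Inn] subgroup.subset[OF subgroup_quandle_auto]
    by (auto simp: quandle_Aut_def)
  ultimately show ?thesis
    by (auto simp: group_action_def group_hom_def group_hom_axioms_def hom_def
        group_BijGroup quandle_Inn_def quandle_Aut_def)
qed

lemma connected_quandle_iff:
  "connected_quandle X m \<longleftrightarrow> (\<forall>x\<in>X. \<forall>y\<in>X. \<exists>f \<in> carrier (quandle_Inn X m). f x = y)"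
  using group_action_quandle_Inn quandle_axioms
  by (auto simp: connected_quandle_def transitive_action_def transitive_action_axioms_def)

end

end

theory Submission
  imports Defs
begin

text \<open>
  In a finite space every point \<open>x\<close> has a smallest open neighbourhood \<open>V x\<close>. A continuous
  self-bijection \<open>f\<close> maps \<open>V x\<close> injectively into \<open>V (f x)\<close>, and summing cardinalities over the
  whole space turns the resulting inequalities into equalities. By connectedness all \<open>V x\<close> therefore
  have the same cardinality, so \<open>y \<in> V x\<close>, i.e. \<open>V y \<subseteq> V x\<close>, forces \<open>V y = V x\<close>, which under
  \<open>T\<^sub>0\<close> means \<open>y = x\<close>.
\<close>

text \<open>For \<open>x\<close> outside \<open>topspace T\<close> the family is empty and the
  intersection is \<open>UNIV\<close>; hence the hypothesis \<open>x \<in> topspace T\<close> in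
  several lemmas below.\<close>

definition min_nbhd :: "'a topology \<Rightarrow> 'a \<Rightarrow> 'a set" where
  "min_nbhd T x = \<Inter>{U. openin T U \<and> x \<in> U}"

lemma min_nbhd_self: "x \<in> min_nbhd T x"
  by (auto simp: min_nbhd_def)

lemma min_nbhd_subset: "\<lbrakk>openin T U; x \<in> U\<rbrakk> \<Longrightarrow> min_nbhd T x \<subseteq> U"
  by (auto simp: min_nbhd_def)

lemma min_nbhd_subset_topspace: "x \<in> topspace T \<Longrightarrow> min_nbhd T x \<subseteq> topspace T"
  by (rule min_nbhd_subset) auto

text \<open>Every open set around \<open>x\<close> contains \<open>y\<close>, so the family
  intersected for \<open>y\<close> includes the one for \<open>x\<close>.\<close>

lemma min_nbhd_mono: "y \<in> min_nbhd T x \<Longrightarrow> min_nbhd T y \<subseteq> min_nbhd T x"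
  by (auto simp: min_nbhd_def)

lemma openin_min_nbhd:
  assumes "finite (topspace T)" "x \<in> topspace T"
  shows "openin T (min_nbhd T x)"
  unfolding min_nbhd_def
proof (rule openin_Inter)
  have "{U. openin T U \<and> x \<in> U} \<subseteq> Pow (topspace T)"
    using openin_subset by auto
  then show "finite {U. openin T U \<and> x \<in> U}"
    using assms(1) finite_subset by blast
qed (use assms(2) in auto)

text \<open>The preimage of an open set around \<open>f x\<close> is an open set around
  \<open>x\<close>, so it contains \<open>min_nbhd T x\<close>.\<close>

lemma continuous_map_min_nbhd:
  assumes "continuous_map T S f" "x \<in> topspace T"
  shows "f ` min_nbhd T x \<subseteq> min_nbhd S (f x)"
proof clarify
  fix y assume y: "y \<in> min_nbhd T x"
  show "f y \<in> min_nbhd S (f x)"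
    unfolding min_nbhd_def
  proof clarify
    fix U assume "openin S U" "f x \<in> U"
    then have "openin T {z \<in> topspace T. f z \<in> U}"
      using assms(1) openin_continuous_map_preimage by blast
    from min_nbhd_subset[OF this] show "f y \<in> U"
      using \<open>f x \<in> U\<close> assms(2) y by auto
  qed
qed

text \<open>Continuity of the inverse of \<open>f\<close> is not assumed, so only one inequality
  comes directly; the other comes from counting over the whole space.\<close>

lemma card_min_nbhd_continuous_bij:
  assumes fin: "finite (topspace T)" and cont: "continuous_map T T f"
    and bij: "bij_betw f (topspace T) (topspace T)" and x: "x \<in> topspace T"
  shows "card (min_nbhd T (f x)) = card (min_nbhd T x)"
proof -
  let ?c = "\<lambda>x. card (min_nbhd T x)"
  have le: "?c x \<le> ?c (f x)" if "x \<in> topspace T" for x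
  proof (rule card_inj_on_le)
    show "inj_on f (min_nbhd T x)"
      using bij min_nbhd_subset_topspace[OF that] by (auto simp: bij_betw_def intro: inj_on_subset)
    show "f ` min_nbhd T x \<subseteq> min_nbhd T (f x)"
      using cont that by (rule continuous_map_min_nbhd)
    show "finite (min_nbhd T (f x))"
      using finite_subset[OF min_nbhd_subset_topspace fin] bij_betwE[OF bij] that by blast
  qed
  \<comment> \<open>As \<open>f\<close> permutes the points, both sides of the inequality
    \<open>le\<close> have the same finite sum, so no single inequality can be strict.\<close>
  have "sum ?c (topspace T) = sum (\<lambda>x. ?c (f x)) (topspace T)"
    by (rule sum.reindex_bij_betw[OF bij, symmetric])
  from sum_mono_inv[OF this le x fin] show ?thesis by simp
qed

lemma t0_space_discrete_if_card_min_nbhd_const: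
  assumes fin: "finite (topspace T)" and "t0_space T"
    and const: "\<And>x y. \<lbrakk>x \<in> topspace T; y \<in> topspace T\<rbrakk>
      \<Longrightarrow> card (min_nbhd T x) = card (min_nbhd T y)"
  shows "T = discrete_topology (topspace T)"
proof -
  have "min_nbhd T x = {x}" if x: "x \<in> topspace T" for x
  proof -
    have "y = x" if y: "y \<in> min_nbhd T x" for y
    proof (rule ccontr)
      assume "y \<noteq> x"
      have yT: "y \<in> topspace T"
        using y min_nbhd_subset_topspace[OF x] by blast
      have "min_nbhd T y = min_nbhd T x"
        using card_subset_eq[OF _ min_nbhd_mono[OF y] const[OF yT x]]
          finite_subset[OF min_nbhd_subset_topspace[OF x] fin] by blast
      \<comment> \<open>Points with the same minimal neighbourhood lie in the same open sets, which
        \<open>t0_space\<close> forbids for distinct points.\<close>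
      then have "x \<in> U \<longleftrightarrow> y \<in> U" if "openin T U" for U
        using min_nbhd_subset[OF that] min_nbhd_self[of x T] min_nbhd_self[of y T] by blast
      then show False
        using \<open>t0_space T\<close> x yT \<open>y \<noteq> x\<close> unfolding t0_space_def by blast
    qed
    then show ?thesis using min_nbhd_self by fast
  qed
  then have "\<forall>x \<in> topspace T. openin T {x}"
    using openin_min_nbhd[OF fin] by metis
  then have "discrete_topology (topspace T) = T"
    by (simp add: discrete_topology_unique)
  then show ?thesis ..
qed

text \<open>Invariance under the generators passes to products and inverses, by induction on
  \<open>generate\<close>. It is applied with \<open>c\<close> the cardinality of the minimal
  neighbourhood.\<close>

lemma (in quandle) invariant_quandle_Inn:
  assumes inv: "\<And>x y. \<lbrakk>x \<in> X; y \<in> X\<rbrakk> \<Longrightarrow> c (right_mult X m y x) = c x"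
    and f: "f \<in> carrier (quandle_Inn X m)" and x: "x \<in> X"
  shows "c (f x) = c x"
proof -
  interpret A: group "quandle_Aut X m" by (rule group_quandle_Aut)
  have maps: "g x \<in> X" if "g \<in> carrier (quandle_Aut X m)" "x \<in> X" for g x
    using that Bij_imp_funcset[of g X] by (auto simp: quandle_Aut_def quandle_auto_def)
  have mult: "(g \<otimes>\<^bsub>quandle_Aut X m\<^esub> h) x = g (h x)"
    if "g \<in> carrier (quandle_Aut X m)" "h \<in> carrier (quandle_Aut X m)" "x \<in> X" for g h x
    using that by (simp add: quandle_Aut_def quandle_auto_def BijGroup_def compose_eq)
  have one_app: "\<one>\<^bsub>quandle_Aut X m\<^esub> x = x" if "x \<in> X" for x
    using that by (simp add: quandle_Aut_def BijGroup_def)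
  have R: "right_mult X m ` X \<subseteq> carrier (quandle_Aut X m)"
    using right_mult_in_auto by (auto simp: quandle_Aut_def)
  have "f \<in> generate (quandle_Aut X m) (right_mult X m ` X)"
    using f by (simp add: quandle_Inn_def)
  then show ?thesis using x
  proof (induction arbitrary: x rule: generate.induct)
    case one
    then show ?case by (simp add: one_app)
  next
    case (incl h)
    then show ?case using inv by auto
  next
    case (inv h)
    then have h: "h \<in> carrier (quandle_Aut X m)" using R by blast
    let ?g = "inv\<^bsub>quandle_Aut X m\<^esub> h"
    \<comment> \<open>Invariance under the generator \<open>h\<close>, taken at the point
      \<open>?g x\<close>, compares \<open>c x\<close> with \<open>c (?g x)\<close>.\<close>
    have "h (?g x) = x"
      using mult[OF h A.inv_closed[OF h] inv.prems] one_app[OF inv.prems] A.r_inv[OF h] by simp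
    moreover have "c (h (?g x)) = c (?g x)"
      using inv.hyps assms(1) maps[OF A.inv_closed[OF h] inv.prems] by auto
    ultimately show ?case by simp
  next
    case (eng h1 h2)
    then have "h1 \<in> carrier (quandle_Aut X m)" "h2 \<in> carrier (quandle_Aut X m)"
      using A.generate_in_carrier[OF R] by blast+
    then show ?case using eng by (simp add: mult maps)
  qed
qed

theorem theorem4p4:
  fixes X :: "'a set" and m :: "'a \<Rightarrow> 'a \<Rightarrow> 'a"
  assumes "quandle X m" and "finite X" and "connected_quandle X m"
  shows "\<not> (\<exists>T. right_topological_quandle X m T \<and> t0_space T \<and> T \<noteq> discrete_topology X)"
proof clarify
  fix T assume rt: "right_topological_quandle X m T" and t0: "t0_space T"
    and nd: "T \<noteq> discrete_topology X"
  interpret quandle X m by fact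
  have top: "topspace T = X" using rt by (simp add: right_topological_quandle_def)
  have "card (min_nbhd T (right_mult X m y x)) = card (min_nbhd T x)"
    if "x \<in> X" "y \<in> X" for x y
  proof (rule card_min_nbhd_continuous_bij)
    show "continuous_map T T (right_mult X m y)"
      using rt that by (simp add: right_topological_quandle_def)
    show "bij_betw (right_mult X m y) (topspace T) (topspace T)"
      using right_mult_in_auto[OF that(2)] by (simp add: quandle_auto_def Bij_def top)
  qed (use that top assms(2) in auto)
  from invariant_quandle_Inn[of "\<lambda>x. card (min_nbhd T x)", OF this]
  have "card (min_nbhd T (f x)) = card (min_nbhd T x)"
    if "f \<in> carrier (quandle_Inn X m)" "x \<in> X" for f x using that by blast
  \<comment> \<open>Transitivity supplies an inner automorphism carrying one point to the
    other.\<close>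
  then have const: "card (min_nbhd T x) = card (min_nbhd T y)" if "x \<in> X" "y \<in> X" for x y
    using assms(3) that unfolding connected_quandle_iff by metis
  have "T = discrete_topology X"
    using t0_space_discrete_if_card_min_nbhd_const[of T, unfolded top, OF assms(2) t0 const] .
  with nd show False ..
qed

end
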